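(* Let $\mathcal{G}=\{G_w : w\in W\}$ be a set-based weighted graph on the complete undirected graph $G=\langle V,E\rangle$, and assume $\mathcal{O}=\mathcal{O_T}$. Then an edge $e\in E$ is strong if and only if every simple cycle of $G$ that contains $e$ contains an edge $e'$ that is dominated by $e$.
   Context: $G=\langle V,E\rangle$ is a fully connected (complete) undirected graph with finite node set $V$, $m=|V|$, and no loops. $W$ is a non-empty set of weight functions $w:E\to\mathbb{R}$; $G_w$ denotes $G$ with edge weights $w$, and $\mathcal{G}=\{G_w: w\in W\}$ is called a set-based weighted graph. For each $w$, a maximum spanning tree of $G_w$ is a spanning tree maximizing the sum of its edge weights under $w$ (there may be several). $\mathcal{T}$ is the set of all maximum spanning trees of all graphs $G_w$, $w\in W$. An edge is strong if it belongs to every tree in $\mathcal{T}$. Dominance: edge $e$ dominates edge $e'$ if $w(e)>w(e')$ for all $w\in W$. This is a strict partial order on $E$. $\mathcal{O}$ is the set of all strict total orders on $E$ extending the dominance partial order. $\mathcal{O_T}$ is the set of all strict total orders on $E$ that are consistent with some graph in $\mathcal{G}$, i.e. for which there is $w\in W$ such that $w(e)\ge w(e')$ whenever $e$ is above $e'$ in the order (equivalently, $w(e)>w(e')$ implies that $e$ is above $e'$). One always has $\mathcal{O_T}\subseteq\mathcal{O}$. A simple cycle is a cycle whose nodes are all different. *)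

theory Defs
  imports Complex_Main
begin

text \<open>
  Undirected loop-free graphs are given by a vertex set and a set of edges, each edge being a
  two-element set of vertices.  A subgraph on all of \<open>V\<close> (in particular a spanning tree) is
  identified with its edge set.
\<close>

definition complete_edges :: "'a set \<Rightarrow> 'a set set" where
  "complete_edges V = {{u, v} | u v. u \<in> V \<and> v \<in> V \<and> u \<noteq> v}"

definition graph_connected :: "'a set \<Rightarrow> 'a set set \<Rightarrow> bool" where
  "graph_connected V F \<longleftrightarrow> (\<forall>u\<in>V. \<forall>v\<in>V. (u, v) \<in> {(x, y). {x, y} \<in> F}\<^sup>*)"

text \<open>
  A cycle is given by the cyclic sequence of its vertices, the first one not being repeated at the
  end: \<open>[x\<^sub>1, \<dots>, x\<^sub>k]\<close> has the edges \<open>{x\<^sub>1, x\<^sub>2}, \<dots>, {x\<^sub>k, x\<^sub>1}\<close>.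
\<close>

definition cycle_edges :: "'a list \<Rightarrow> 'a set set" where
  "cycle_edges xs = set (map2 (\<lambda>u v. {u, v}) xs (rotate1 xs))"

text \<open>
  The length bound rules out traversing a single edge back and forth.
\<close>

definition simple_cycle :: "'a set set \<Rightarrow> 'a list \<Rightarrow> bool" where
  "simple_cycle F xs \<longleftrightarrow> 3 \<le> length xs \<and> distinct xs \<and> cycle_edges xs \<subseteq> F"

definition spanning_tree :: "'a set \<Rightarrow> 'a set set \<Rightarrow> bool" where
  "spanning_tree V T \<longleftrightarrow>
     T \<subseteq> complete_edges V \<and> graph_connected V T \<and> (\<nexists>xs. simple_cycle T xs)"

definition max_spanning_tree :: "'a set \<Rightarrow> ('a set \<Rightarrow> real) \<Rightarrow> 'a set set \<Rightarrow> bool" where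
  "max_spanning_tree V w T \<longleftrightarrow> is_arg_max (\<lambda>T'. \<Sum>e\<in>T'. w e) (spanning_tree V) T"

text \<open>
  Weight functions are total functions on sets of vertices; only their values on
  \<open>complete_edges V\<close> matter below.
\<close>

definition max_spanning_trees :: "'a set \<Rightarrow> ('a set \<Rightarrow> real) set \<Rightarrow> 'a set set set" where
  "max_spanning_trees V W = {T. \<exists>w\<in>W. max_spanning_tree V w T}"

definition strong :: "'a set \<Rightarrow> ('a set \<Rightarrow> real) set \<Rightarrow> 'a set \<Rightarrow> bool" where
  "strong V W e \<longleftrightarrow> (\<forall>T\<in>max_spanning_trees V W. e \<in> T)"

definition dominates :: "('a set \<Rightarrow> real) set \<Rightarrow> 'a set \<Rightarrow> 'a set \<Rightarrow> bool" where
  "dominates W e e' \<longleftrightarrow> (\<forall>w\<in>W. w e > w e')"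

text \<open>
  In the strict total orders \<open>r\<close> below, \<open>(e, e') \<in> r\<close> means that \<open>e\<close> is \<^emph>\<open>above\<close> \<open>e'\<close>.
\<close>

definition strict_total_orders :: "'b set \<Rightarrow> 'b rel set" where
  "strict_total_orders E = {r. r \<subseteq> E \<times> E \<and> strict_linear_order_on E r}"

definition dominance_orders :: "'a set \<Rightarrow> ('a set \<Rightarrow> real) set \<Rightarrow> 'a set rel set" where
  "dominance_orders V W =
     {r \<in> strict_total_orders (complete_edges V).
        \<forall>e\<in>complete_edges V. \<forall>e'\<in>complete_edges V. dominates W e e' \<longrightarrow> (e, e') \<in> r}"

definition consistent_orders :: "'a set \<Rightarrow> ('a set \<Rightarrow> real) set \<Rightarrow> 'a set rel set" where
  "consistent_orders V W =
     {r \<in> strict_total_orders (complete_edges V). \<exists>w\<in>W. \<forall>(e, e')\<in>r. w e \<ge> w e'}"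

end

theory Submission
  imports Defs
begin

text \<open>
  Both directions are exchange arguments.  If a maximum spanning tree \<open>T\<close> misses \<open>e\<close>, then \<open>e\<close>
  closes a cycle with \<open>T\<close>, and swapping an edge of that cycle dominated by \<open>e\<close> for \<open>e\<close> increases the
  weight.  Conversely, let \<open>C\<close> be a cycle through \<open>e\<close> none of whose edges is dominated by \<open>e\<close>.  Putting
  \<open>e\<close> and everything it dominates at the bottom and breaking ties by some \<open>w\<^sub>0 \<in> W\<close> yields an order
  extending dominance in which \<open>e\<close> is below the rest of \<open>C\<close>.  A weight function \<open>w \<in> W\<close> consistent with
  this order makes \<open>e\<close> a lightest edge of \<open>C\<close>, so in any maximum spanning tree of \<open>w\<close> the edge \<open>e\<close> can
  be exchanged for another edge of \<open>C\<close>.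
\<close>

abbreviation reach :: "'a set set \<Rightarrow> 'a rel" where
  "reach F \<equiv> {(x, y). {x, y} \<in> F}\<^sup>*"

subsection \<open>Reachability and cycles\<close>

lemma reach_sym: "(x, y) \<in> reach F \<Longrightarrow> (y, x) \<in> reach F"
proof -
  have "sym {(x, y). {x, y} \<in> F}"
    by (auto simp: sym_def insert_commute)
  then show "(x, y) \<in> reach F \<Longrightarrow> (y, x) \<in> reach F"
    by (blast intro: symD sym_rtrancl)
qed

lemma reach_mono: "F \<subseteq> F' \<Longrightarrow> (x, y) \<in> reach F \<Longrightarrow> (x, y) \<in> reach F'"
  by (rule rtrancl_mono[THEN subsetD, of "{(x, y). {x, y} \<in> F}"]) auto

lemma reach_edge: "{x, y} \<in> F \<Longrightarrow> (x, y) \<in> reach F"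
  by (rule r_into_rtrancl) simp

text \<open>Each passage through \<open>{a, b}\<close> is rerouted along the given walk from
  \<open>a\<close> to \<open>b\<close> in \<open>F'\<close>, or its reverse. For a swap of edges
  this serves both connectedness and the absence of cycles.\<close>

lemma reach_replace_edge:
  assumes "(x, y) \<in> reach F" and "F - {{a, b}} \<subseteq> F'" and "(a, b) \<in> reach F'"
  shows "(x, y) \<in> reach F'"
  using assms(1)
proof (induction rule: rtrancl_induct)
  case (step y z)
  have "(y, z) \<in> reach F'"
  proof (cases "{y, z} = {a, b}")
    case True
    then show ?thesis
      using assms(3) reach_sym[OF assms(3)] by (auto simp: doubleton_eq_iff)
  next
    case False
    then show ?thesis
      using step.hyps assms(2) by (intro reach_edge) auto
  qed
  then show ?case
    using step.IH by (rule rtrancl_trans[rotated])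
qed simp

text \<open>After its last passage through the new edge, the walk stays in \<open>F\<close> and
  starts from an end of that edge.\<close>

lemma reach_insert_cases:
  assumes "(x, y) \<in> reach (insert {u, v} F)"
  shows "(x, y) \<in> reach F \<or> (u, y) \<in> reach F \<or> (v, y) \<in> reach F"
  using assms
proof (induction rule: rtrancl_induct)
  case (step y z)
  then show ?case
    by (cases "{y, z} = {u, v}") (auto simp: doubleton_eq_iff intro: rtrancl_into_rtrancl)
qed simp

lemma graph_connected_replace_edge:
  assumes "graph_connected V F" and "F - {{a, b}} \<subseteq> F'" and "(a, b) \<in> reach F'"
  shows "graph_connected V F'"
  using assms(1) reach_replace_edge[OF _ assms(2,3)] unfolding graph_connected_def by blast

lemma reach_imp_distinct_path:
  assumes "(u, v) \<in> reach F"
  shows "\<exists>xs. distinct xs \<and> xs \<noteq> [] \<and> hd xs = u \<and> last xs = v \<and>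
    successively (\<lambda>x y. {x, y} \<in> F) xs"
  using assms
proof (induction rule: converse_rtrancl_induct)
  case base
  show ?case
    by (rule exI[of _ "[v]"]) simp
next
  case (step u y)
  then obtain xs where xs: "distinct xs" "xs \<noteq> []" "hd xs = y" "last xs = v"
    "successively (\<lambda>x y. {x, y} \<in> F) xs"
    by blast
  show ?case
  proof (cases "u \<in> set xs")
    \<comment> \<open>The new start already lies on the path: cutting off everything before it keeps
      the vertices distinct.\<close>
    case True
    then obtain ys zs where "xs = ys @ u # zs"
      by (meson split_list)
    then show ?thesis
      using xs by (intro exI[of _ "u # zs"]) (auto simp: successively_append_iff)
  next
    case False
    then show ?thesis
      using xs step.hyps by (intro exI[of _ "u # xs"]) (auto simp: successively_Cons)
  qed
qed

lemma cycle_edges_conv_nth: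
  "cycle_edges xs = {{xs ! i, xs ! (Suc i mod length xs)} | i. i < length xs}"
  unfolding cycle_edges_def set_conv_nth by (simp add: nth_rotate1 cong: rev_conj_cong)

text \<open>A path without repeated vertices from \<open>u\<close> to \<open>v\<close> is closed up
  by the edge \<open>{u, v}\<close>, which becomes the wrap-around edge of the cyclic list.\<close>

lemma reach_imp_simple_cycle:
  assumes "(u, v) \<in> reach F" and "u \<noteq> v" and "{u, v} \<notin> F"
  obtains xs where "simple_cycle (insert {u, v} F) xs" and "{u, v} \<in> cycle_edges xs"
proof -
  obtain xs where xs: "distinct xs" "xs \<noteq> []" "hd xs = u" "last xs = v"
    "successively (\<lambda>x y. {x, y} \<in> F) xs"
    using reach_imp_distinct_path[OF assms(1)] by blast
  \<comment> \<open>A path with one vertex would give \<open>u = v\<close>, one with two vertices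
    would put \<open>{u, v}\<close> into \<open>F\<close>.\<close>
  have len: "3 \<le> length xs"
  proof (rule ccontr)
    assume "\<not> 3 \<le> length xs"
    then have "length xs = Suc 0 \<or> length xs = Suc (Suc 0)"
      using xs(2) length_greater_0_conv[of xs] by arith
    then show False
      using xs assms by (auto simp: length_Suc_conv)
  qed
  have ends: "xs ! 0 = u" "xs ! (length xs - 1) = v"
    using xs by (simp_all add: hd_conv_nth last_conv_nth)
  have "{xs ! i, xs ! (Suc i mod length xs)} \<in> insert {u, v} F" if "i < length xs" for i
  proof (cases "Suc i = length xs")
    case True
    then have "i = length xs - 1"
      by simp
    then show ?thesis
      using True ends by (simp add: insert_commute)
  next
    case False
    then show ?thesis
      using that xs(5) by (simp add: successively_conv_nth)
  qed
  then have "simple_cycle (insert {u, v} F) xs"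
    using xs(1) len unfolding simple_cycle_def cycle_edges_conv_nth by auto
  moreover have "{u, v} \<in> cycle_edges xs"
    unfolding cycle_edges_conv_nth
    using ends xs(2) by (intro CollectI exI[of _ "length xs - 1"]) (simp add: insert_commute)
  ultimately show thesis
    by (rule that)
qed

text \<open>The ends of a cycle edge are joined by going round the cycle the other way: if the edge
  starts at index \<open>i\<close>, the walk starts at \<open>Suc i\<close> and takes
  \<open>n - 1\<close> steps modulo \<open>n\<close>.\<close>

lemma simple_cycle_reach:
  assumes "simple_cycle F xs" and "{u, v} \<in> cycle_edges xs"
  shows "(u, v) \<in> reach (cycle_edges xs - {{u, v}})"
proof -
  define n where "n = length xs"
  have n: "3 \<le> n" and dist: "distinct xs"
    using assms(1) by (simp_all add: simple_cycle_def n_def)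
  obtain i where i: "i < n" and uv: "{u, v} = {xs ! i, xs ! (Suc i mod n)}"
    using assms(2) by (auto simp: cycle_edges_conv_nth n_def)
  let ?R = "reach (cycle_edges xs - {{u, v}})"
  have eq_iff: "xs ! (j mod n) = xs ! (k mod n) \<longleftrightarrow> j mod n = k mod n" for j k
    using nth_eq_iff_index_eq[OF dist] n by (simp flip: n_def)
  have walk: "(xs ! (Suc i mod n), xs ! ((Suc i + k) mod n)) \<in> ?R" if "k < n" for k
    using that
  proof (induction k)
    case (Suc k)
    \<comment> \<open>The step from \<open>Suc i + k\<close> could traverse the removed edge in
      either direction. The forward direction would make \<open>n\<close> divide
      \<open>Suc k\<close>, although \<open>Suc k < n\<close>.\<close>
    have not_i: "(Suc i + k) mod n \<noteq> i mod n"
    proof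
      assume "(Suc i + k) mod n = i mod n"
      then have "n dvd Suc k"
        using mod_eq_dvd_iff_nat[of i "Suc i + k" n] by simp
      then show False
        using Suc.prems by (simp add: nat_dvd_not_less)
    qed
    \<comment> \<open>The backward direction would force \<open>k = 0\<close> and then
      \<open>n dvd 2\<close>, which the length bound on cycles excludes.\<close>
    have "\<not> ((Suc i + k) mod n = Suc i mod n \<and> (Suc i + Suc k) mod n = i mod n)"
    proof (intro notI, elim conjE)
      assume "(Suc i + k) mod n = Suc i mod n" "(Suc i + Suc k) mod n = i mod n"
      then have "n dvd k" "n dvd Suc (Suc k)"
        using mod_eq_dvd_iff_nat[of "Suc i" "Suc i + k" n]
          mod_eq_dvd_iff_nat[of i "Suc i + Suc k" n] by simp_all
      then have "k = 0"
        using Suc.prems by (auto dest: dvd_imp_le)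
      then show False
        using \<open>n dvd Suc (Suc k)\<close> n by (auto dest: dvd_imp_le)
    qed
    then have "{xs ! ((Suc i + k) mod n), xs ! ((Suc i + Suc k) mod n)} \<noteq>
        {xs ! (i mod n), xs ! (Suc i mod n)}"
      using not_i unfolding doubleton_eq_iff eq_iff by blast
    then have "{xs ! ((Suc i + k) mod n), xs ! ((Suc i + Suc k) mod n)} \<noteq> {u, v}"
      using i uv by simp
    moreover have "{xs ! ((Suc i + k) mod n), xs ! ((Suc i + Suc k) mod n)} \<in> cycle_edges xs"
      unfolding cycle_edges_conv_nth n_def[symmetric]
      using n by (auto simp: mod_Suc_eq intro!: exI[of _ "(Suc i + k) mod n"])
    ultimately have "(xs ! ((Suc i + k) mod n), xs ! ((Suc i + Suc k) mod n)) \<in> ?R"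
      by (intro reach_edge) simp
    then show ?case
      using Suc by (auto intro: rtrancl_trans)
  qed simp
  have "(Suc i + (n - 1)) mod n = i"
    using i by simp
  then have "(xs ! (Suc i mod n), xs ! i) \<in> ?R"
    using walk[of "n - 1"] n by simp
  then show ?thesis
    using uv reach_sym unfolding doubleton_eq_iff by metis
qed

subsection \<open>Spanning trees\<close>

lemma complete_edgesE:
  assumes "e \<in> complete_edges V"
  obtains u v where "e = {u, v}" "u \<in> V" "v \<in> V" "u \<noteq> v"
  using assms unfolding complete_edges_def by blast

lemma finite_complete_edges: "finite V \<Longrightarrow> finite (complete_edges V)"
  by (rule finite_subset[of _ "Pow V"]) (auto simp: complete_edges_def)

lemma simple_cycle_mono: "simple_cycle F xs \<Longrightarrow> F \<subseteq> F' \<Longrightarrow> simple_cycle F' xs"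
  by (auto simp: simple_cycle_def)

text \<open>A detour around a tree edge would close a cycle with it inside the tree.\<close>

lemma spanning_tree_bridge:
  assumes "spanning_tree V T" and "{a, b} \<in> T"
  shows "(a, b) \<notin> reach (T - {{a, b}})"
proof
  assume "(a, b) \<in> reach (T - {{a, b}})"
  moreover have "a \<noteq> b"
    using assms by (auto simp: spanning_tree_def complete_edges_def)
  ultimately obtain xs where "simple_cycle (insert {a, b} (T - {{a, b}})) xs"
    by (rule reach_imp_simple_cycle) auto
  then show False
    using assms by (simp add: spanning_tree_def insert_absorb)
qed

lemma spanning_tree_exchange:
  assumes T: "spanning_tree V T" and f: "{a, b} \<in> T" and e: "e \<in> complete_edges V"
    and ab: "(a, b) \<in> reach (insert e (T - {{a, b}}))"
  shows "spanning_tree V (insert e (T - {{a, b}}))"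
proof -
  let ?T = "insert e (T - {{a, b}})"
  have "graph_connected V ?T"
    by (rule graph_connected_replace_edge[OF _ _ ab, of _ T]) (use T in \<open>auto simp: spanning_tree_def\<close>)
  moreover have "\<not> simple_cycle ?T xs" for xs
  proof
    assume cyc: "simple_cycle ?T xs"
    obtain u v where uv: "e = {u, v}"
      using e by (rule complete_edgesE)
    have "e \<in> cycle_edges xs"
    proof (rule ccontr)
      assume "e \<notin> cycle_edges xs"
      then have "simple_cycle T xs"
        using cyc by (auto simp: simple_cycle_def)
      then show False
        using T by (auto simp: spanning_tree_def)
    qed
    \<comment> \<open>The rest of the cycle is a detour around \<open>e\<close> inside
      \<open>T - {{a, b}}\<close>. Using it in place of \<open>e\<close> joins \<open>a\<close> and
      \<open>b\<close> there, although \<open>{a, b}\<close> is a bridge of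
      \<open>T\<close>.\<close>
    then have "(u, v) \<in> reach (cycle_edges xs - {{u, v}})"
      using simple_cycle_reach[OF cyc] uv by simp
    then have "(u, v) \<in> reach (T - {{a, b}})"
      by (rule reach_mono[rotated]) (use cyc uv in \<open>auto simp: simple_cycle_def\<close>)
    then have "(a, b) \<in> reach (T - {{a, b}})"
      by (rule reach_replace_edge[OF ab, rotated]) (use uv in auto)
    then show False
      using spanning_tree_bridge[OF T f] by blast
  qed
  ultimately show ?thesis
    using T e by (auto simp: spanning_tree_def)
qed

section \<open>Existence of spanning trees and maximum spanning trees\<close>

lemma spanning_tree_exists:
  assumes "finite V"
  shows "\<exists>T. spanning_tree V T"
proof -
  let ?A = "{F. F \<subseteq> complete_edges V \<and> graph_connected V F}"
  have "graph_connected V (complete_edges V)"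
    unfolding graph_connected_def
  proof (intro ballI)
    fix u v assume "u \<in> V" "v \<in> V"
    then show "(u, v) \<in> reach (complete_edges V)"
      by (cases "u = v") (auto simp: complete_edges_def intro!: reach_edge)
  qed
  then have "?A \<noteq> {}"
    by blast
  moreover have "finite ?A"
    using finite_complete_edges[OF assms] by simp
  ultimately obtain T where T: "T \<in> ?A" and min: "\<And>F. F \<in> ?A \<Longrightarrow> F \<subseteq> T \<Longrightarrow> F = T"
    using finite_has_minimal[of ?A] by metis
  \<comment> \<open>Deleting an edge of a cycle keeps the graph connected, so a minimal connected
    edge set has no cycle.\<close>
  have "\<not> simple_cycle T xs" for xs
  proof
    assume cyc: "simple_cycle T xs"
    then have "{xs ! 0, xs ! (Suc 0 mod length xs)} \<in> cycle_edges xs"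
      unfolding cycle_edges_conv_nth simple_cycle_def
      by (intro CollectI exI[of _ 0]) auto
    then obtain a b where ab: "{a, b} \<in> cycle_edges xs"
      by blast
    have "(a, b) \<in> reach (T - {{a, b}})"
      using simple_cycle_reach[OF cyc ab]
      by (rule reach_mono[rotated]) (use cyc in \<open>auto simp: simple_cycle_def\<close>)
    then have "graph_connected V (T - {{a, b}})"
      by (rule graph_connected_replace_edge[rotated -1]) (use T in auto)
    then have "T - {{a, b}} = T"
      using T by (intro min) auto
    then show False
      using cyc ab by (auto simp: simple_cycle_def)
  qed
  then show ?thesis
    using T by (auto simp: spanning_tree_def)
qed

lemma max_spanning_tree_iff:
  "max_spanning_tree V w T \<longleftrightarrow>
    spanning_tree V T \<and> (\<forall>T'. spanning_tree V T' \<longrightarrow> sum w T' \<le> sum w T)"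
  by (auto simp: max_spanning_tree_def is_arg_max_def not_less)

lemma max_spanning_tree_exists:
  assumes "finite V"
  shows "\<exists>T. max_spanning_tree V w T"
proof -
  have "Collect (spanning_tree V) \<subseteq> Pow (complete_edges V)"
    by (auto simp: spanning_tree_def)
  then have "finite (Collect (spanning_tree V))"
    using finite_complete_edges[OF assms] by (meson finite_Pow_iff finite_subset)
  moreover have "Collect (spanning_tree V) \<noteq> {}"
    using spanning_tree_exists[OF assms] by blast
  ultimately have fin: "finite (sum w ` Collect (spanning_tree V))"
    and ne: "sum w ` Collect (spanning_tree V) \<noteq> {}"
    by auto
  from Max_in[OF fin ne] obtain T
    where "spanning_tree V T" "sum w T = Max (sum w ` Collect (spanning_tree V))"
    by auto
  then show ?thesis
    using Max_ge[OF fin] by (auto simp: max_spanning_tree_iff)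
qed

section \<open>Exchanges in maximum spanning trees\<close>

lemma sum_exchange:
  fixes w :: "'b \<Rightarrow> real"
  assumes "finite T" and "f \<in> T" and "e \<notin> T"
  shows "sum w (insert e (T - {f})) = sum w T - w f + w e"
  using assms by (simp add: sum_diff1)

text \<open>Only one weight function is involved, and the lighter edge may depend on it; dominance
  provides an edge that is lighter for all \<open>w\<close> in \<open>W\<close>.\<close>

lemma max_spanning_tree_contains:
  assumes "finite V" and e: "e \<in> complete_edges V" and T: "max_spanning_tree V w T"
    and cycles: "\<And>xs. simple_cycle (complete_edges V) xs \<Longrightarrow> e \<in> cycle_edges xs \<Longrightarrow>
      \<exists>e'\<in>cycle_edges xs. w e > w e'"
  shows "e \<in> T"
proof (rule ccontr)
  assume notin: "e \<notin> T"
  obtain u v where uv: "e = {u, v}" "u \<in> V" "v \<in> V" "u \<noteq> v"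
    using e by (rule complete_edgesE)
  have tree: "spanning_tree V T" and sub: "T \<subseteq> complete_edges V"
    using T by (auto simp: max_spanning_tree_iff spanning_tree_def)
  have "(u, v) \<in> reach T"
    using tree uv by (simp add: spanning_tree_def graph_connected_def)
  then obtain xs where cyc: "simple_cycle (insert e T) xs" and "e \<in> cycle_edges xs"
    using reach_imp_simple_cycle notin uv by metis
  moreover have "simple_cycle (complete_edges V) xs"
    using cyc sub e by (auto intro: simple_cycle_mono)
  ultimately obtain e' where e': "e' \<in> cycle_edges xs" "w e > w e'"
    using cycles by blast
  \<comment> \<open>Being strictly lighter, \<open>e'\<close> differs from \<open>e\<close>, so it
    is one of the tree edges on the cycle.\<close>
  then have "e' \<in> T"
    using cyc by (auto simp: simple_cycle_def)
  then obtain a b where ab: "e' = {a, b}"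
    using sub by (blast elim: complete_edgesE)
  have "(a, b) \<in> reach (cycle_edges xs - {{a, b}})"
    using simple_cycle_reach[OF cyc] e' ab by simp
  then have "(a, b) \<in> reach (insert e (T - {{a, b}}))"
    by (rule reach_mono[rotated]) (use cyc in \<open>auto simp: simple_cycle_def\<close>)
  then have "spanning_tree V (insert e (T - {e'}))"
    using spanning_tree_exchange[OF tree _ e] \<open>e' \<in> T\<close> ab by simp
  then have "sum w (insert e (T - {e'})) \<le> sum w T"
    using T by (simp add: max_spanning_tree_iff)
  moreover have "finite T"
    using finite_complete_edges[OF assms(1)] sub by (rule finite_subset[rotated])
  ultimately show False
    using sum_exchange[of T e' e w] \<open>e' \<in> T\<close> notin e' by simp
qed

text \<open>Deleting \<open>e\<close> splits the tree into two components. The rest of the cycle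
  leads from one to the other, so one of its edges crosses the cut and can replace
  \<open>e\<close>.\<close>

lemma spanning_tree_cycle_exchange:
  assumes T: "spanning_tree V T" and "e \<in> T"
    and cyc: "simple_cycle (complete_edges V) xs" and "e \<in> cycle_edges xs"
  obtains f where "f \<in> cycle_edges xs - {e}" "f \<notin> T" "spanning_tree V (insert f (T - {e}))"
proof -
  have sub: "T \<subseteq> complete_edges V"
    using T by (simp add: spanning_tree_def)
  then obtain u v where uv: "e = {u, v}" "u \<in> V" "v \<in> V"
    using \<open>e \<in> T\<close> by (blast elim: complete_edgesE)
  let ?R = "reach (T - {e})"
  have bridge: "(u, v) \<notin> ?R"
    using spanning_tree_bridge[OF T] \<open>e \<in> T\<close> uv by simp
  have path: "(u, v) \<in> reach (cycle_edges xs - {e})"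
    using simple_cycle_reach[OF cyc] assms(4) uv by simp
  have "\<exists>a b. {a, b} \<in> cycle_edges xs - {e} \<and> (u, a) \<in> ?R \<and> (u, b) \<notin> ?R"
  proof (rule ccontr)
    assume none: "\<nexists>a b. {a, b} \<in> cycle_edges xs - {e} \<and> (u, a) \<in> ?R \<and> (u, b) \<notin> ?R"
    from path have "(u, v) \<in> ?R"
      by (induction rule: rtrancl_induct) (use none in blast)+
    then show False
      using bridge by blast
  qed
  then obtain a b where ab: "{a, b} \<in> cycle_edges xs - {e}" "(u, a) \<in> ?R" "(u, b) \<notin> ?R"
    by blast
  have f: "{a, b} \<in> complete_edges V"
    using ab(1) cyc by (auto simp: simple_cycle_def)
  then have "b \<in> V"
    by (auto simp: complete_edges_def doubleton_eq_iff)
  then have "(u, b) \<in> reach (insert {u, v} (T - {e}))"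
    using T \<open>e \<in> T\<close> uv by (simp add: spanning_tree_def graph_connected_def insert_absorb)
  \<comment> \<open>As \<open>T\<close> is connected, a vertex outside the component of
    \<open>u\<close> lies in that of \<open>v\<close>. Hence \<open>{a, b}\<close> reconnects the
    two.\<close>
  then have "(v, b) \<in> ?R"
    using reach_insert_cases[of u b u v "T - {e}"] ab(3) by simp
  have "{a, b} \<notin> T"
    using ab reach_edge[of a b "T - {e}"] by (auto intro: rtrancl_trans)
  moreover have "(u, v) \<in> reach (insert {a, b} (T - {e}))"
  proof -
    have mono: "(x, y) \<in> reach (insert {a, b} (T - {e}))" if "(x, y) \<in> ?R" for x y
      using that by (rule reach_mono[rotated]) auto
    have "(a, b) \<in> reach (insert {a, b} (T - {e}))"
      by (rule reach_edge) simp
    with mono[OF ab(2)] mono[OF reach_sym[OF \<open>(v, b) \<in> ?R\<close>]] show ?thesis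
      by (meson rtrancl_trans)
  qed
  then have "spanning_tree V (insert {a, b} (T - {e}))"
    using spanning_tree_exchange[OF T _ f] \<open>e \<in> T\<close> uv by simp
  ultimately show thesis
    using that ab(1) by blast
qed

text \<open>Ties are harmless: an exchange that loses no weight turns one maximum spanning tree into
  another.\<close>

lemma max_spanning_tree_avoiding:
  assumes "finite V" and cyc: "simple_cycle (complete_edges V) xs" and "e \<in> cycle_edges xs"
    and light: "\<And>f. f \<in> cycle_edges xs - {e} \<Longrightarrow> w e \<le> w f"
  shows "\<exists>T. max_spanning_tree V w T \<and> e \<notin> T"
proof -
  obtain T where T: "max_spanning_tree V w T"
    using max_spanning_tree_exists[OF assms(1)] by blast
  show ?thesis
  proof (cases "e \<in> T")
    case True
    have tree: "spanning_tree V T"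
      using T by (simp add: max_spanning_tree_iff)
    obtain f where f: "f \<in> cycle_edges xs - {e}" "f \<notin> T" "spanning_tree V (insert f (T - {e}))"
      using spanning_tree_cycle_exchange[OF tree True cyc assms(3)] by blast
    have "finite T"
      using finite_complete_edges[OF assms(1)] tree
      by (auto simp: spanning_tree_def intro: finite_subset)
    then have "sum w T \<le> sum w (insert f (T - {e}))"
      using sum_exchange[of T e f w] True f light by simp
    then have "max_spanning_tree V w (insert f (T - {e}))"
      using T f(3) by (fastforce simp: max_spanning_tree_iff)
    then show ?thesis
      using f(1) by blast
  qed (use T in blast)
qed

subsection \<open>Dominance\<close>

lemma dominance_order_exists:
  assumes "finite V" and "W \<noteq> {}"
  obtains r where "r \<in> dominance_orders V W"
    and "\<And>f. f \<in> complete_edges V - {e} \<Longrightarrow> e \<in> complete_edges V \<Longrightarrow> \<not> dominates W e f \<Longrightarrow> (f, e) \<in> r"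
proof -
  let ?E = "complete_edges V"
  obtain w where w: "w \<in> W"
    using assms(2) by blast
  \<comment> \<open>An arbitrary injective numbering separates edges of equal weight, which makes
    the order below total.\<close>
  obtain g :: "'a set \<Rightarrow> nat" where g: "inj_on g ?E"
    using finite_imp_inj_to_nat_seg[OF finite_complete_edges[OF assms(1)]] by blast
  define D where "D = insert e {f. dominates W e f}"
  \<comment> \<open>A lexicographic order: first the edges outside \<open>D\<close>, then larger
    weight under \<open>w\<close>, then larger number.\<close>
  define r where "r = {(x, y). x \<in> ?E \<and> y \<in> ?E \<and>
    (x \<notin> D \<and> y \<in> D \<or> (x \<in> D \<longleftrightarrow> y \<in> D) \<and> (w x > w y \<or> w x = w y \<and> g x > g y))}"
  have "trans r"
    unfolding r_def trans_def by auto
  moreover have "irrefl r"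
    unfolding r_def irrefl_def by auto
  moreover have "total_on ?E r"
    unfolding r_def total_on_def using g by (auto simp: inj_on_def) (metis linorder_less_linear)+
  ultimately have "r \<in> strict_total_orders ?E"
    unfolding strict_total_orders_def strict_linear_order_on_def by (auto simp: r_def)
  moreover have "(x, y) \<in> r" if "x \<in> ?E" "y \<in> ?E" "dominates W x y" for x y
  proof -
    \<comment> \<open>Since dominance is transitive, \<open>D\<close> is closed under passing to
      dominated edges. So the first criterion never contradicts dominance, and within a block the
      weight under \<open>w\<close> decides correctly.\<close>
    have "y \<in> D" if "x \<in> D"
      using that \<open>dominates W x y\<close> unfolding D_def dominates_def by force
    then show ?thesis
      using that w unfolding r_def dominates_def by auto
  qed
  ultimately have "r \<in> dominance_orders V W"
    by (simp add: dominance_orders_def)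
  moreover have "(f, e) \<in> r" if "f \<in> ?E - {e}" "e \<in> ?E" "\<not> dominates W e f" for f
    using that unfolding r_def D_def by auto
  ultimately show thesis
    using that by blast
qed

section \<open>Strong edges characterized by cycles\<close>

theorem theorem2:
  fixes V :: "'a set"
    and W :: "('a set \<Rightarrow> real) set"
    and e :: "'a set"
  assumes "finite V"
    and "W \<noteq> {}"
    and "dominance_orders V W = consistent_orders V W"
    and "e \<in> complete_edges V"
  shows "strong V W e \<longleftrightarrow>
    (\<forall>xs. simple_cycle (complete_edges V) xs \<and> e \<in> cycle_edges xs \<longrightarrow>
       (\<exists>e'\<in>cycle_edges xs. dominates W e e'))"
proof
  assume strong: "strong V W e"
  show "\<forall>xs. simple_cycle (complete_edges V) xs \<and> e \<in> cycle_edges xs \<longrightarrow>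
    (\<exists>e'\<in>cycle_edges xs. dominates W e e')"
  proof (intro allI impI, elim conjE, rule ccontr)
    fix xs
    assume cyc: "simple_cycle (complete_edges V) xs" "e \<in> cycle_edges xs"
      and not_dom: "\<not> (\<exists>e'\<in>cycle_edges xs. dominates W e e')"
    obtain r where r: "r \<in> dominance_orders V W"
      and below: "\<And>f. f \<in> complete_edges V - {e} \<Longrightarrow> e \<in> complete_edges V \<Longrightarrow>
        \<not> dominates W e f \<Longrightarrow> (f, e) \<in> r"
      using dominance_order_exists[OF assms(1,2), where e = e] by blast
    \<comment> \<open>The equality of the two sets of orders enters here: an order built from
      dominance alone is realized by an actual weight function.\<close>
    obtain w where w: "w \<in> W" "\<forall>(f, f') \<in> r. w f \<ge> w f'"
      using r assms(3) by (auto simp: consistent_orders_def)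
    have "w e \<le> w f" if "f \<in> cycle_edges xs - {e}" for f
    proof -
      have "(f, e) \<in> r"
        using that cyc(1) not_dom assms(4) by (intro below) (auto simp: simple_cycle_def)
      then show ?thesis
        using w(2) by blast
    qed
    then obtain T where "max_spanning_tree V w T" "e \<notin> T"
      using max_spanning_tree_avoiding[OF assms(1) cyc] by blast
    then show False
      using strong w(1) by (auto simp: strong_def max_spanning_trees_def)
  qed
next
  assume cycles: "\<forall>xs. simple_cycle (complete_edges V) xs \<and> e \<in> cycle_edges xs \<longrightarrow>
    (\<exists>e'\<in>cycle_edges xs. dominates W e e')"
  show "strong V W e"
    unfolding strong_def max_spanning_trees_def
  proof clarify
    fix w T assume w: "w \<in> W" and T: "max_spanning_tree V w T"
    show "e \<in> T"
    proof (rule max_spanning_tree_contains[OF assms(1,4) T])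
      fix xs assume "simple_cycle (complete_edges V) xs" "e \<in> cycle_edges xs"
      then obtain e' where "e' \<in> cycle_edges xs" "dominates W e e'"
        using cycles by blast
      then show "\<exists>e'\<in>cycle_edges xs. w e > w e'"
        using w by (auto simp: dominates_def)
    qed
  qed
qed

end
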